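(* For a Puiseux monoid $M$, the following statements are equivalent. (1) $M$ is nowhere dense. (2) Each generating set of $M$ is nowhere dense. If statement (1) or statement (2) holds, then $M$ is atomic and $\mathcal{A}(M)$ is nowhere dense.
   Context: A Puiseux monoid is an additive submonoid of $(\mathbb{Q}_{\ge 0},+)$. An atom of a Puiseux monoid $M$ is an element $a\in M\setminus\{0\}$ such that whenever $a=u+v$ with $u,v\in M$, either $u=0$ or $v=0$; $\mathcal{A}(M)$ denotes the set of atoms of $M$. A subset $S\subseteq M$ is a generating set of $M$ if no proper submonoid of $M$ contains $S$. $M$ is atomic if $\mathcal{A}(M)$ is a generating set of $M$. For $A,B\subseteq\mathbb{R}$, $A$ is dense in $B$ if $A\cap B$ is a dense subset of $B$ with the Euclidean subspace topology. A subset $A$ of $\mathbb{R}_{\ge 0}$ (in particular, a Puiseux monoid) is nowhere dense if for all $r,s\in\mathbb{R}_{\ge 0}$ with $r<s$, $A$ is not dense in the open interval $(r,s)$; equivalently, the closure of $A$ has empty interior. *)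

theory Defs
  imports "HOL-Analysis.Analysis"
begin

definition additive_submonoid :: "'a::comm_monoid_add set \<Rightarrow> 'a set \<Rightarrow> bool" where
  "additive_submonoid N M \<longleftrightarrow> N \<subseteq> M \<and> 0 \<in> N \<and> (\<forall>x\<in>N. \<forall>y\<in>N. x + y \<in> N)"

text \<open>Puiseux monoids are taken as subsets of the real line, so that density refers to the
  Euclidean topology without a coercion; \<open>\<rat> \<inter> {0..}\<close> is the monoid of nonnegative rationals.\<close>

definition puiseux_monoid :: "real set \<Rightarrow> bool" where
  "puiseux_monoid M \<longleftrightarrow> additive_submonoid M (\<rat> \<inter> {0..})"

definition atoms :: "'a::comm_monoid_add set \<Rightarrow> 'a set" where
  "atoms M = {a \<in> M - {0}. \<forall>u\<in>M. \<forall>v\<in>M. a = u + v \<longrightarrow> u = 0 \<or> v = 0}"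

definition generating_set :: "'a::comm_monoid_add set \<Rightarrow> 'a set \<Rightarrow> bool" where
  "generating_set S M \<longleftrightarrow> S \<subseteq> M \<and> \<not> (\<exists>N. additive_submonoid N M \<and> N \<noteq> M \<and> S \<subseteq> N)"

definition atomic_monoid :: "'a::comm_monoid_add set \<Rightarrow> bool" where
  "atomic_monoid M \<longleftrightarrow> generating_set (atoms M) M"

text \<open>\<open>A\<close> need not be contained in \<open>B\<close>.\<close>

definition dense_in :: "'a::topological_space set \<Rightarrow> 'a set \<Rightarrow> bool" where
  "dense_in A B \<longleftrightarrow> (top_of_set B) closure_of (A \<inter> B) = B"

text \<open>Intended for subsets of the nonnegative reals: only intervals with endpoints there
  are tested.\<close>

definition nowhere_dense :: "real set \<Rightarrow> bool" where
  "nowhere_dense A \<longleftrightarrow> (\<forall>r s. 0 \<le> r \<and> r < s \<longrightarrow> \<not> dense_in A {r<..<s})"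

end

theory Submission
  imports Defs
begin

text \<open>If \<open>0\<close> were a limit point of \<open>M - {0}\<close>, the multiples of arbitrarily small elements would make
  \<open>M\<close> dense in every interval. So a nowhere dense \<open>M\<close> has its nonzero elements bounded below by some
  \<open>e > 0\<close>; splitting a non-atom into two nonzero summands lowers each of them by at least \<open>e\<close>, hence
  repeated splitting terminates in atoms. The rest is monotonicity, as \<open>M\<close> generates itself.\<close>

text \<open>The closure of \<open>A \<inter> B\<close> in the subspace \<open>B\<close> is
  \<open>B \<inter> closure (A \<inter> B)\<close>.\<close>

lemma dense_in_iff_subset_closure: "dense_in A B \<longleftrightarrow> B \<subseteq> closure (A \<inter> B)"
  unfolding dense_in_def by (auto simp: closure_of_subtopology Int_ac)

lemma nowhere_dense_mono:
  assumes "nowhere_dense B" "A \<subseteq> B"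
  shows "nowhere_dense A"
proof -
  have "closure (A \<inter> I) \<subseteq> closure (B \<inter> I)" for I
    using assms(2) by (intro closure_mono) auto
  then show ?thesis
    using assms(1) unfolding nowhere_dense_def dense_in_iff_subset_closure by (meson subset_trans)
qed

lemma generating_set_self: "generating_set M M"
  by (auto simp: generating_set_def additive_submonoid_def)

lemma puiseux_monoidD:
  assumes "puiseux_monoid M"
  shows "0 \<in> M" "\<And>x. x \<in> M \<Longrightarrow> 0 \<le> x" "\<And>x y. x \<in> M \<Longrightarrow> y \<in> M \<Longrightarrow> x + y \<in> M"
  using assms unfolding puiseux_monoid_def additive_submonoid_def by auto

lemma puiseux_monoid_of_nat_mult:
  assumes "puiseux_monoid M" "m \<in> M"
  shows "of_nat n * m \<in> M"
  using assms by (induction n) (auto simp: algebra_simps puiseux_monoidD)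

text \<open>The multiples of \<open>m\<close> form a grid of step \<open>m\<close>, so each
  \<open>x \<ge> 0\<close> has one in the half-open interval from \<open>x - m\<close> (excluded) to
  \<open>x\<close>.\<close>

lemma dense_in_of_arbitrarily_small:
  assumes M: "puiseux_monoid M"
    and small: "\<And>e. e > 0 \<Longrightarrow> \<exists>m\<in>M. 0 < m \<and> m < e"
    and r: "0 \<le> r"
  shows "dense_in M {r<..<s}"
  unfolding dense_in_iff_subset_closure
proof
  fix x assume x: "x \<in> {r<..<s}"
  show "x \<in> closure (M \<inter> {r<..<s})"
    unfolding closure_approachable
  proof (intro allI impI)
    fix e :: real assume "e > 0"
    \<comment> \<open>The bound \<open>e\<close> gives closeness to \<open>x\<close>; the bound
      \<open>x - r\<close> keeps the multiple below \<open>x\<close> above \<open>r\<close>.\<close>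
    with x small[of "min e (x - r)"] obtain m where m: "m \<in> M" "0 < m" "m < e" "m < x - r"
      by auto
    define n where "n = nat \<lfloor>x / m\<rfloor>"
    \<comment> \<open>\<open>nat\<close> truncates nothing: \<open>0 \<le> r < x\<close> makes the
      quotient positive.\<close>
    have n: "real n = of_int \<lfloor>x / m\<rfloor>"
      using x r m unfolding n_def by auto
    have "real n \<le> x / m" "x / m < real n + 1"
      unfolding n by linarith+
    then have "real n * m \<le> x" "x < real n * m + m"
      using m(2) by (auto simp: field_simps)
    moreover have "real n * m \<in> M"
      using M m(1) by (rule puiseux_monoid_of_nat_mult)
    ultimately show "\<exists>y\<in>M \<inter> {r<..<s}. dist y x < e"
      using x m by (intro bexI[of _ "real n * m"]) (auto simp: dist_real_def)
  qed
qed

lemma nowhere_dense_imp_gap: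
  assumes "puiseux_monoid M" "nowhere_dense M"
  obtains e where "e > 0" "\<And>m. m \<in> M \<Longrightarrow> m \<noteq> 0 \<Longrightarrow> e \<le> m"
proof -
  \<comment> \<open>Any one interval would do, since arbitrarily small elements force density in all
    of them.\<close>
  have "\<not> dense_in M {0<..<1}"
    using assms(2) unfolding nowhere_dense_def by simp
  then obtain e where e: "e > 0" "\<not> (\<exists>m\<in>M. 0 < m \<and> m < e)"
    using dense_in_of_arbitrarily_small[OF assms(1), of 0 1] by auto
  have "e \<le> m" if "m \<in> M" "m \<noteq> 0" for m
    using e(2) that puiseux_monoidD(2)[OF assms(1) that(1)] by force
  with e(1) show ?thesis by (rule that)
qed

lemma gap_imp_atomic_monoid:
  assumes M: "puiseux_monoid M"
    and e: "e > 0" and gap: "\<And>m. m \<in> M \<Longrightarrow> m \<noteq> 0 \<Longrightarrow> e \<le> m"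
  shows "atomic_monoid M"
proof -
  have "M \<subseteq> N" if N: "additive_submonoid N M" "atoms M \<subseteq> N" for N
  proof -
    \<comment> \<open>The size of \<open>x\<close> in units of \<open>e\<close> is the induction
      measure; for \<open>n = 0\<close> it would make \<open>x\<close> negative.\<close>
    have "x \<in> N" if "x \<in> M" "x < real n * e" for x n
      using that
    proof (induction n arbitrary: x)
      case 0
      then show ?case using puiseux_monoidD(2)[OF M, of x] by simp
    next
      case (Suc n)
      consider "x = 0" | "x \<in> atoms M"
        | u v where "u \<in> M" "v \<in> M" "x = u + v" "u \<noteq> 0" "v \<noteq> 0"
        using Suc.prems(1) unfolding atoms_def by blast
      then show ?case
      proof cases
        case 1
        then show ?thesis using N(1) unfolding additive_submonoid_def by simp
      next
        case 2
        then show ?thesis using N(2) by blast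
      next
        case 3
        \<comment> \<open>Each summand is \<open>x\<close> minus the other one, which is at least
          \<open>e\<close>.\<close>
        have "u < real n * e" "v < real n * e"
          using gap[of u] gap[of v] 3 Suc.prems(2) by (auto simp: algebra_simps)
        then have "u \<in> N" "v \<in> N"
          using Suc.IH 3 by blast+
        then show ?thesis using N(1) 3(3) unfolding additive_submonoid_def by blast
      qed
    qed
    \<comment> \<open>By the Archimedean property every \<open>x\<close> lies below some multiple of
      \<open>e\<close>.\<close>
    then show ?thesis
      using ex_less_of_nat_mult[OF e] by (meson subsetI)
  qed
  then show ?thesis
    unfolding atomic_monoid_def generating_set_def
    by (auto simp: atoms_def additive_submonoid_def)
qed

theorem proposition3p10:
  fixes M :: "real set"
  assumes "puiseux_monoid M"
  shows "(nowhere_dense M \<longleftrightarrow> (\<forall>S. generating_set S M \<longrightarrow> nowhere_dense S)) \<and>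
    (nowhere_dense M \<or> (\<forall>S. generating_set S M \<longrightarrow> nowhere_dense S) \<longrightarrow>
      atomic_monoid M \<and> nowhere_dense (atoms M))"
proof -
  have iff: "nowhere_dense M \<longleftrightarrow> (\<forall>S. generating_set S M \<longrightarrow> nowhere_dense S)"
    using generating_set_self[of M] nowhere_dense_mono[of M]
    by (auto simp: generating_set_def[of _ M])
  moreover have "atomic_monoid M" "nowhere_dense (atoms M)" if "nowhere_dense M"
  proof -
    show "atomic_monoid M"
      by (rule nowhere_dense_imp_gap[OF assms that]) (rule gap_imp_atomic_monoid[OF assms])
    show "nowhere_dense (atoms M)"
      using that by (rule nowhere_dense_mono) (auto simp: atoms_def)
  qed
  ultimately show ?thesis by blast
qed

end
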